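(* Let $G$ be a finite group of order $n$, $A=(a_0,\dots,a_{n-1})$ an ordering of its elements, and let $\mu$ be a stable matching of the regular anti-phase template $P(G,A)$ with index function $d$. Let $b=\max_{g\in G}d_g$ and suppose $b\ge 1$. Put $q_b=a_{b-1}a_b^{-1}$, $D_b=\{g\in G: d_g=b\}$ and $H_b=\langle q_b\rangle$. Then $$g\in D_b\ \Longrightarrow\ gq_b\in D_b,$$ so $D_b$ is a union of left cosets of $H_b$. In particular $|H_b|$ divides $|D_b|$.
   Context: A strict complete profile consists of equally many men and women, each with a strict total order over all participants of the opposite side. A matching is a bijection $\mu$ from men to women. A pair $(m,w)$ blocks $\mu$ if $m$ prefers $w$ to $\mu(m)$ and $w$ prefers $m$ to $\mu^{-1}(w)$; $\mu$ is stable if no pair blocks it. An ordering of $G$ is a tuple listing each element exactly once. The regular anti-phase template $P(G,A)$ is the profile with men $m_g$ and women $w_g$ indexed by $g\in G$ and lists $$m_g:\ w_{ga_0}\succ w_{ga_1}\succ\cdots\succ w_{ga_{n-1}},\qquad w_h:\ m_{ha_{n-1}^{-1}}\succ m_{ha_{n-2}^{-1}}\succ\cdots\succ m_{ha_0^{-1}}.$$ The index function of a matching $\mu$ of $P(G,A)$ is the function $d:G\to\{0,\dots,n-1\}$ determined by $\mu(m_g)=w_{ga_{d_g}}$. *)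

theory Defs
  imports "HOL-Algebra.Left_Coset" "HOL-Algebra.Generated_Groups"
begin

text \<open>A pair \<open>(x, y)\<close> in \<open>men_pref P m\<close> or \<open>women_pref P w\<close> means that \<open>x\<close> is preferred to \<open>y\<close>.\<close>

record ('m, 'w) profile =
  men :: "'m set"
  women :: "'w set"
  men_pref :: "'m \<Rightarrow> 'w rel"
  women_pref :: "'w \<Rightarrow> 'm rel"

text \<open>\<^const>\<open>strict_linear_order_on\<close> does not bound the field of the relation, hence the
  inclusions.\<close>

definition strict_complete_profile :: "('m, 'w) profile \<Rightarrow> bool" where
  "strict_complete_profile P \<longleftrightarrow>
     finite (men P) \<and> finite (women P) \<and> card (men P) = card (women P) \<and>
     (\<forall>m\<in>men P. men_pref P m \<subseteq> women P \<times> women P \<and>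
        strict_linear_order_on (women P) (men_pref P m)) \<and>
     (\<forall>w\<in>women P. women_pref P w \<subseteq> men P \<times> men P \<and>
        strict_linear_order_on (men P) (women_pref P w))"

definition matching :: "('m, 'w) profile \<Rightarrow> ('m \<Rightarrow> 'w) \<Rightarrow> bool" where
  "matching P \<mu> \<longleftrightarrow> bij_betw \<mu> (men P) (women P)"

definition blocks :: "('m, 'w) profile \<Rightarrow> ('m \<Rightarrow> 'w) \<Rightarrow> 'm \<Rightarrow> 'w \<Rightarrow> bool" where
  "blocks P \<mu> m w \<longleftrightarrow> m \<in> men P \<and> w \<in> women P \<and>
     (w, \<mu> m) \<in> men_pref P m \<and> (m, inv_into (men P) \<mu> w) \<in> women_pref P w"

definition stable_matching :: "('m, 'w) profile \<Rightarrow> ('m \<Rightarrow> 'w) \<Rightarrow> bool" where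
  "stable_matching P \<mu> \<longleftrightarrow> matching P \<mu> \<and> (\<nexists>m w. blocks P \<mu> m w)"

definition list_order :: "'a list \<Rightarrow> 'a rel" where
  "list_order xs = {(xs ! i, xs ! j) | i j. i < j \<and> j < length xs}"

definition ordering_of :: "('a, 'b) monoid_scheme \<Rightarrow> 'a list \<Rightarrow> bool" where
  "ordering_of G A \<longleftrightarrow> distinct A \<and> set A = carrier G"

datatype 'a man = Man 'a
datatype 'a woman = Woman 'a

definition regular_template ::
  "('a, 'b) monoid_scheme \<Rightarrow> 'a list \<Rightarrow> ('a man, 'a woman) profile" where
  "regular_template G A =
     \<lparr> men = Man ` carrier G,
       women = Woman ` carrier G,
       men_pref = (\<lambda>m. case m of Man g \<Rightarrow>
         list_order (map (\<lambda>a. Woman (g \<otimes>\<^bsub>G\<^esub> a)) A)),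
       women_pref = (\<lambda>w. case w of Woman h \<Rightarrow>
         list_order (map (\<lambda>a. Man (h \<otimes>\<^bsub>G\<^esub> inv\<^bsub>G\<^esub> a)) (rev A))) \<rparr>"

text \<open>Only the values of \<open>d\<close> on the carrier matter; there they are determined by \<open>\<mu>\<close>
  (lemma \<open>ex1_index\<close> below).\<close>

definition index_function ::
  "('a, 'b) monoid_scheme \<Rightarrow> 'a list \<Rightarrow> ('a man \<Rightarrow> 'a woman) \<Rightarrow> ('a \<Rightarrow> nat) \<Rightarrow> bool" where
  "index_function G A \<mu> d \<longleftrightarrow>
     (\<forall>g\<in>carrier G. d g < order G \<and> \<mu> (Man g) = Woman (g \<otimes>\<^bsub>G\<^esub> A ! d g))"

lemma list_order_subset: "list_order xs \<subseteq> set xs \<times> set xs"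
  by (auto simp: list_order_def)

lemma strict_linear_order_on_list_order:
  assumes "distinct xs"
  shows "strict_linear_order_on (set xs) (list_order xs)"
proof -
  have "trans (list_order xs)"
  proof (rule transI)
    fix x y z assume "(x, y) \<in> list_order xs" "(y, z) \<in> list_order xs"
    then obtain i j k l where
      "x = xs ! i" "y = xs ! j" "i < j" "j < length xs"
      "y = xs ! k" "z = xs ! l" "k < l" "l < length xs"
      by (auto simp: list_order_def)
    moreover from this have "j = k"
      using assms by (metis nth_eq_iff_index_eq order.strict_trans)
    ultimately show "(x, z) \<in> list_order xs"
      unfolding list_order_def by force
  qed
  moreover have "irrefl (list_order xs)"
    using assms by (auto simp: irrefl_def list_order_def nth_eq_iff_index_eq)
  moreover have "total_on (set xs) (list_order xs)"
  proof (rule total_onI)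
    fix x y assume "x \<in> set xs" "y \<in> set xs" "x \<noteq> y"
    then obtain i j where "x = xs ! i" "y = xs ! j" "i < length xs" "j < length xs" "i \<noteq> j"
      by (metis in_set_conv_nth)
    then show "(x, y) \<in> list_order xs \<or> (y, x) \<in> list_order xs"
      unfolding list_order_def by (cases "i < j") (force, force)
  qed
  ultimately show ?thesis
    by (simp add: strict_linear_order_on_def)
qed

lemma strict_complete_profile_regular_template:
  assumes "group G" "finite (carrier G)" "ordering_of G A"
  shows "strict_complete_profile (regular_template G A)"
proof -
  interpret group G by fact
  have A: "distinct A" "set A = carrier G"
    using assms(3) by (auto simp: ordering_of_def)
  have m: "distinct (map (\<lambda>a. Woman (g \<otimes>\<^bsub>G\<^esub> a)) A)"
          "set (map (\<lambda>a. Woman (g \<otimes>\<^bsub>G\<^esub> a)) A) = Woman ` carrier G"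
    if g: "g \<in> carrier G" for g
  proof -
    show "distinct (map (\<lambda>a. Woman (g \<otimes>\<^bsub>G\<^esub> a)) A)"
      using A g by (auto simp: distinct_map inj_on_def)
    have "(\<lambda>a. g \<otimes>\<^bsub>G\<^esub> a) ` carrier G = carrier G"
      using surj_const_mult[OF g] .
    then show "set (map (\<lambda>a. Woman (g \<otimes>\<^bsub>G\<^esub> a)) A) = Woman ` carrier G"
      using A by (metis image_image list.set_map)
  qed
  have w: "distinct (map (\<lambda>a. Man (h \<otimes>\<^bsub>G\<^esub> inv\<^bsub>G\<^esub> a)) (rev A))"
          "set (map (\<lambda>a. Man (h \<otimes>\<^bsub>G\<^esub> inv\<^bsub>G\<^esub> a)) (rev A)) = Man ` carrier G"
    if h: "h \<in> carrier G" for h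
  proof -
    show "distinct (map (\<lambda>a. Man (h \<otimes>\<^bsub>G\<^esub> inv\<^bsub>G\<^esub> a)) (rev A))"
      using A h by (auto simp: distinct_map inj_on_def dest: inj_onD[OF inv_inj])
    have "(\<lambda>a. h \<otimes>\<^bsub>G\<^esub> inv\<^bsub>G\<^esub> a) ` carrier G = (\<lambda>a. h \<otimes>\<^bsub>G\<^esub> a) ` (m_inv G ` carrier G)"
      by (simp add: image_image)
    also have "m_inv G ` carrier G = carrier G"
      by (force simp: image_iff intro: inv_inv[symmetric])
    also have "(\<lambda>a. h \<otimes>\<^bsub>G\<^esub> a) ` carrier G = carrier G"
      using surj_const_mult[OF h] .
    finally show "set (map (\<lambda>a. Man (h \<otimes>\<^bsub>G\<^esub> inv\<^bsub>G\<^esub> a)) (rev A)) = Man ` carrier G"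
      using A by (metis image_image list.set_map set_rev)
  qed
  have "men_pref (regular_template G A) x \<subseteq> Woman ` carrier G \<times> Woman ` carrier G \<and>
        strict_linear_order_on (Woman ` carrier G) (men_pref (regular_template G A) x)"
    if x: "x \<in> Man ` carrier G" for x
  proof -
    obtain g where g: "g \<in> carrier G" "x = Man g"
      using x by auto
    have "men_pref (regular_template G A) x = list_order (map (\<lambda>a. Woman (g \<otimes>\<^bsub>G\<^esub> a)) A)"
      using g(2) by (simp add: regular_template_def)
    then show ?thesis
      using list_order_subset[of "map (\<lambda>a. Woman (g \<otimes>\<^bsub>G\<^esub> a)) A"]
        strict_linear_order_on_list_order[OF m(1)[OF g(1)]]
      by (simp only: m(2)[OF g(1)])
  qed
  moreover have "women_pref (regular_template G A) x \<subseteq> Man ` carrier G \<times> Man ` carrier G \<and>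
        strict_linear_order_on (Man ` carrier G) (women_pref (regular_template G A) x)"
    if x: "x \<in> Woman ` carrier G" for x
  proof -
    obtain g where g: "g \<in> carrier G" "x = Woman g"
      using x by auto
    have "women_pref (regular_template G A) x = list_order (map (\<lambda>a. Man (g \<otimes>\<^bsub>G\<^esub> inv\<^bsub>G\<^esub> a)) (rev A))"
      using g(2) by (simp add: regular_template_def)
    then show ?thesis
      using list_order_subset[of "map (\<lambda>a. Man (g \<otimes>\<^bsub>G\<^esub> inv\<^bsub>G\<^esub> a)) (rev A)"]
        strict_linear_order_on_list_order[OF w(1)[OF g(1)]]
      by (simp only: w(2)[OF g(1)])
  qed
  moreover have "men (regular_template G A) = Man ` carrier G"
                "women (regular_template G A) = Woman ` carrier G"
    by (simp_all add: regular_template_def)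
  ultimately show ?thesis
    using assms(2) by (simp add: strict_complete_profile_def card_image inj_on_def)
qed

lemma ex1_index:
  assumes "group G" "finite (carrier G)" "ordering_of G A"
    and "matching (regular_template G A) \<mu>" and g: "g \<in> carrier G"
  shows "\<exists>!i. i < order G \<and> \<mu> (Man g) = Woman (g \<otimes>\<^bsub>G\<^esub> A ! i)"
proof -
  interpret group G by fact
  have A: "distinct A" "set A = carrier G" "length A = order G"
    using assms(3) distinct_card[of A] by (auto simp: ordering_of_def order_def)
  have "\<mu> (Man g) \<in> Woman ` carrier G"
    using assms(4) g by (auto simp: matching_def regular_template_def dest: bij_betwE)
  then obtain h where h: "h \<in> carrier G" "\<mu> (Man g) = Woman h"
    by auto
  have "inv\<^bsub>G\<^esub> g \<otimes>\<^bsub>G\<^esub> h \<in> set A"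
    using A g h by simp
  then obtain i where i: "i < order G" "A ! i = inv\<^bsub>G\<^esub> g \<otimes>\<^bsub>G\<^esub> h"
    using A by (metis in_set_conv_nth)
  show ?thesis
  proof (rule ex1I[of _ i])
    show "i < order G \<and> \<mu> (Man g) = Woman (g \<otimes>\<^bsub>G\<^esub> A ! i)"
      using i h g by (simp add: m_assoc[symmetric])
  next
    fix j assume j: "j < order G \<and> \<mu> (Man g) = Woman (g \<otimes>\<^bsub>G\<^esub> A ! j)"
    then have "A ! j \<in> carrier G"
      using A nth_mem by metis
    then have "A ! j = A ! i"
      using j i h g by (simp add: m_assoc[symmetric])
    then show "j = i"
      using A i(1) j by (simp add: nth_eq_iff_index_eq)
  qed
qed

end

theory Submission
  imports Defs "HOL-Algebra.Multiplicative_Group"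
begin

text \<open>The woman \<open>w\<close> whom \<open>m\<^sub>g\<close> ranks at position \<open>i\<close> ranks \<open>m\<^sub>g\<close> at the mirrored position \<open>n - 1 - i\<close>.
  If \<open>i < d\<^sub>g\<close>, then \<open>m\<^sub>g\<close> prefers \<open>w\<close> to his partner, so stability forces the index of \<open>w\<close>'s
  partner to be at least \<open>i\<close>. For \<open>g \<in> D\<^sub>b\<close> and \<open>i = b - 1\<close>, that index is \<open>b - 1\<close> or \<open>b\<close>; the
  former would make the partner \<open>m\<^sub>g\<close> himself, so it is \<open>b\<close> and the partner is
  the man indexed by \<open>g q\<^sub>b\<close>.\<close>

lemma list_order_mapI:
  assumes "i < j" "j < length xs"
  shows "(f (xs ! i), f (xs ! j)) \<in> list_order (map f xs)"
  using assms unfolding list_order_def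
  by (intro CollectI exI[of _ i] exI[of _ j]) simp

text \<open>Reversal sends position \<open>k\<close> to \<open>length xs - Suc k\<close>, which
  flips the comparison of positions. This serves the women's lists, which run through
  \<open>A\<close> backwards.\<close>

lemma list_order_map_revI:
  assumes "i < j" "j < length xs"
  shows "(f (xs ! j), f (xs ! i)) \<in> list_order (map f (rev xs))"
  using list_order_mapI[of "length xs - Suc j" "length xs - Suc i" "rev xs" f] assms
  by (simp add: rev_nth)

lemma ordering_of_length:
  "ordering_of G A \<Longrightarrow> length A = order G"
  using distinct_card[of A] by (simp add: ordering_of_def order_def)

lemma ordering_of_nth_closed:
  "ordering_of G A \<Longrightarrow> i < length A \<Longrightarrow> A ! i \<in> carrier G"
  unfolding ordering_of_def by (metis nth_mem)

text \<open>Otherwise \<open>Man g\<close> and the woman \<open>g \<otimes> A ! i\<close> would form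
  a blocking pair.\<close>

lemma (in group) stable_index_le:
  assumes A: "ordering_of G A"
    and stable: "stable_matching (regular_template G A) \<mu>"
    and d: "index_function G A \<mu> d"
    and g: "g \<in> carrier G" and h: "h \<in> carrier G"
    and i: "i < d g" and eq: "g \<otimes> A ! i = h \<otimes> A ! d h"
  shows "i \<le> d h"
proof (rule ccontr)
  assume "\<not> i \<le> d h"
  then have hi: "d h < i" by simp
  let ?P = "regular_template G A"
  let ?w = "Woman (g \<otimes> A ! i)"
  have dg: "d g < length A" and \<mu>: "\<mu> (Man g) = Woman (g \<otimes> A ! d g)" "\<mu> (Man h) = ?w"
    using d g h eq ordering_of_length[OF A] by (auto simp: index_function_def)
  have Ai: "A ! i \<in> carrier G" and Adh: "A ! d h \<in> carrier G"
    using ordering_of_nth_closed[OF A] i hi dg by auto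
  have "inj_on \<mu> (men ?P)"
    using stable by (simp add: stable_matching_def matching_def bij_betw_def)
  moreover have "Man h \<in> men ?P"
    using h by (simp add: regular_template_def)
  ultimately have inv: "inv_into (men ?P) \<mu> ?w = Man h"
    using \<mu>(2) by (metis inv_into_f_f)
  have "(?w, \<mu> (Man g)) \<in> men_pref ?P (Man g)"
    using list_order_mapI[OF i dg, of "\<lambda>a. Woman (g \<otimes> a)"] \<mu>(1)
    by (simp add: regular_template_def)
  \<comment> \<open>In the list of \<open>?w\<close>, \<open>Man g\<close> is the entry coming from
    \<open>A ! i\<close> and \<open>Man h\<close> the one coming from \<open>A ! d h\<close>; since
    the list follows \<open>rev A\<close>, \<open>d h < i\<close> puts \<open>Man g\<close>
    first.\<close>
  moreover have "(Man g, Man h) \<in> women_pref ?P ?w"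
  proof -
    have "g \<otimes> A ! i \<otimes> inv (A ! i) = g"
      using g Ai by (simp add: m_assoc)
    moreover have "g \<otimes> A ! i \<otimes> inv (A ! d h) = h"
      unfolding eq using h Adh by (simp add: m_assoc)
    ultimately show ?thesis
      using list_order_map_revI[of "d h" i A "\<lambda>a. Man (g \<otimes> A ! i \<otimes> inv a)"] hi i dg
      by (simp add: regular_template_def)
  qed
  ultimately have "blocks ?P \<mu> (Man g) ?w"
    using g Ai inv by (simp add: blocks_def regular_template_def)
  then show False
    using stable by (auto simp: stable_matching_def)
qed

lemma (in group) stable_max_index_closed:
  assumes fin: "finite (carrier G)" and A: "ordering_of G A"
    and stable: "stable_matching (regular_template G A) \<mu>"
    and d: "index_function G A \<mu> d"
    and b: "b = Max (d ` carrier G)" "b \<ge> 1"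
    and g: "g \<in> carrier G" "d g = b"
  shows "g \<otimes> (A ! (b - 1) \<otimes> inv (A ! b)) \<in> carrier G"
    and "d (g \<otimes> (A ! (b - 1) \<otimes> inv (A ! b))) = b"
proof -
  have "b < length A"
    using d g ordering_of_length[OF A] by (auto simp: index_function_def)
  then have Ab: "A ! b \<in> carrier G" "A ! (b - 1) \<in> carrier G"
    using ordering_of_nth_closed[OF A] by auto
  then show "g \<otimes> (A ! (b - 1) \<otimes> inv (A ! b)) \<in> carrier G"
    using g by simp
  \<comment> \<open>Surjectivity of \<open>\<mu>\<close> supplies the partner \<open>Man h\<close>
    of the woman at position \<open>b - 1\<close> in the list of \<open>Man g\<close>.\<close>
  have "Woman (g \<otimes> A ! (b - 1)) \<in> \<mu> ` Man ` carrier G"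
    using stable g Ab
    by (simp add: stable_matching_def matching_def bij_betw_def regular_template_def)
  then obtain h where h: "h \<in> carrier G" "\<mu> (Man h) = Woman (g \<otimes> A ! (b - 1))"
    by auto
  then have eq: "g \<otimes> A ! (b - 1) = h \<otimes> A ! d h"
    using d by (simp add: index_function_def)
  have "b - 1 \<le> d h"
    using stable_index_le[OF A stable d g(1) h(1) _ eq] g b by simp
  moreover have "d h \<le> b"
    using h fin b by simp
  \<comment> \<open>If \<open>d h = b - 1\<close>, cancelling \<open>A ! (b - 1)\<close> in
    \<open>eq\<close> gives \<open>h = g\<close>, whose index is \<open>b\<close>, and
    \<open>b \<noteq> b - 1\<close> because \<open>b \<ge> 1\<close>.\<close>
  moreover have "d h \<noteq> b - 1"
    using eq g h(1) Ab b by auto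
  ultimately have dh: "d h = b"
    by linarith
  have "g \<otimes> (A ! (b - 1) \<otimes> inv (A ! b)) = g \<otimes> A ! (b - 1) \<otimes> inv (A ! b)"
    using g Ab by (simp add: m_assoc)
  also have "\<dots> = h"
    unfolding eq dh using h Ab by (simp add: m_assoc)
  finally show "d (g \<otimes> (A ! (b - 1) \<otimes> inv (A ! b))) = b"
    using dh by simp
qed

text \<open>In a finite group every element of the cyclic subgroup is a power of \<open>q\<close>
  with a natural exponent, so induction on the exponent reaches it without dividing by
  \<open>q\<close>.\<close>

lemma (in group) mult_generate_closed:
  assumes "finite (carrier G)" "q \<in> carrier G" "D \<subseteq> carrier G"
    and closed: "\<And>g. g \<in> D \<Longrightarrow> g \<otimes> q \<in> D"
    and "g \<in> D" "h \<in> generate G {q}"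
  shows "g \<otimes> h \<in> D"
proof -
  obtain k :: nat where k: "h = q [^] k"
    using generate_pow_on_finite_carrier[OF assms(1,2)] assms(6) by auto
  have "g \<otimes> q [^] k \<in> D"
  proof (induction k)
    case 0
    then show ?case using assms by auto
  next
    case (Suc k)
    then show ?case
      using closed[OF Suc] assms by (auto simp: m_assoc subsetD)
  qed
  then show ?thesis by (simp add: k)
qed

text \<open>Take the cosets \<open>g <# H\<close> with \<open>g \<in> D\<close>: each contains its
  representative \<open>g\<close> and stays inside \<open>D\<close> by closure.\<close>

lemma (in group) union_lcosetsI:
  assumes H: "subgroup H G" and D: "D \<subseteq> carrier G"
    and closed: "\<And>g h. g \<in> D \<Longrightarrow> h \<in> H \<Longrightarrow> g \<otimes> h \<in> D"
  shows "\<exists>\<C>. \<C> \<subseteq> lcosets H \<and> D = \<Union>\<C>"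
proof (intro exI conjI)
  show "(\<lambda>g. g <# H) ` D \<subseteq> lcosets H"
    using D by (auto simp: LCOSETS_def)
  show "D = \<Union>((\<lambda>g. g <# H) ` D)"
  proof
    show "D \<subseteq> \<Union>((\<lambda>g. g <# H) ` D)"
      using D lcos_self[OF _ H] by blast
    show "\<Union>((\<lambda>g. g <# H) ` D) \<subseteq> D"
      using closed by (auto simp: l_coset_def)
  qed
qed

text \<open>Distinct left cosets are disjoint and each has \<open>card H\<close> elements.\<close>

lemma (in group) card_subgroup_dvd_union_lcosets:
  assumes fin: "finite (carrier G)" and H: "subgroup H G" and \<C>: "\<C> \<subseteq> lcosets H"
  shows "card H dvd card (\<Union>\<C>)"
proof (rule dvd_partition)
  show "finite (\<Union>\<C>)"
    using fin \<C> lcosets_part_G[OF H] by (metis Union_mono finite_subset)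
  show "\<forall>c\<in>\<C>. card H dvd card c"
    using \<C> l_card_cosets_equal[OF _ subgroup.subset[OF H] fin] by (metis dvd_refl subsetD)
  show "\<forall>c1\<in>\<C>. \<forall>c2\<in>\<C>. c1 \<noteq> c2 \<longrightarrow> c1 \<inter> c2 = {}"
    using \<C> lcos_disjoint[OF H] by blast
qed

theorem lemma5p5:
  fixes G :: "('a, 'b) monoid_scheme" (structure)
    and n b :: nat
    and A :: "'a list"
    and \<mu> :: "'a man \<Rightarrow> 'a woman"
    and d :: "'a \<Rightarrow> nat"
    and q :: 'a
    and D H :: "'a set"
  assumes "group G" and "finite (carrier G)" and "order G = n"
    and "ordering_of G A"
    and "stable_matching (regular_template G A) \<mu>"
    and "index_function G A \<mu> d"
    and "b = Max (d ` carrier G)" and "b \<ge> 1"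
    and "q = A ! (b - 1) \<otimes> inv (A ! b)"
    and "D = {g \<in> carrier G. d g = b}"
    and "H = generate G {q}"
  shows "(\<forall>g. g \<in> D \<longrightarrow> g \<otimes> q \<in> D)
    \<and> (\<exists>\<C>. \<C> \<subseteq> lcosets H \<and> D = \<Union>\<C>)
    \<and> card H dvd card D"
proof -
  interpret group G by fact
  have D: "D \<subseteq> carrier G"
    using assms(10) by auto
  have closed: "g \<otimes> q \<in> D" if "g \<in> D" for g
    using stable_max_index_closed[OF assms(2,4,5,6,7,8)] that assms(9,10) by simp
  \<comment> \<open>The carrier is finite and nonempty, so the maximum is attained; hence
    \<open>b\<close> is a valid position in \<open>A\<close>, and \<open>q\<close> is a group
    element.\<close>
  have "b \<in> d ` carrier G"
    unfolding assms(7) using assms(2) by (intro Max_in) auto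
  then have "b < length A"
    using assms(6) ordering_of_length[OF assms(4)] by (auto simp: index_function_def)
  then have q: "q \<in> carrier G"
    using assms(9) ordering_of_nth_closed[OF assms(4)] by simp
  have H: "subgroup H G"
    unfolding assms(11) using q by (intro generate_is_subgroup) simp
  have "g \<otimes> h \<in> D" if "g \<in> D" "h \<in> H" for g h
    using mult_generate_closed[OF assms(2) q D closed] that assms(11) by simp
  then obtain \<C> where \<C>: "\<C> \<subseteq> lcosets H" "D = \<Union>\<C>"
    using union_lcosetsI[OF H D] by blast
  moreover have "card H dvd card D"
    unfolding \<C>(2) by (rule card_subgroup_dvd_union_lcosets[OF assms(2) H \<C>(1)])
  ultimately show ?thesis
    using closed by blast
qed

end
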